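(* Let $G$ be a graph on $n$ vertices, and let $\rho=\lambda_1(B_G)$ be the spectral radius of its non-backtracking matrix $B_G$. Suppose $\rho>1$. Then $G$ contains a cycle of size at most $2(\lfloor\log_\rho n\rfloor+1)$ and a bicycle of size at most $3(\lfloor\log_\rho 2n\rfloor+1)$.
   Context: Graphs are finite, simple and undirected. For a graph $G$ with $m$ edges, the non-backtracking matrix $B_G\in\{0,1\}^{2m\times2m}$ is indexed by directed edges (each edge in both orientations), with $B_G[(u_1,v_1),(u_2,v_2)]=1$ if $v_1=u_2$ and $u_1\neq v_2$, and $0$ otherwise. Its eigenvalue of largest absolute value $\lambda_1(B_G)$ is real and nonnegative and equals the spectral radius. The excess of a graph $(V,E)$ is $|E|-|V|$. A bicycle in $G$ is a connected subgraph of $G$ of excess $1$; the size of a cycle or bicycle is its number of vertices. *)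

theory Defs
  imports
    Complex_Main
    "Graph_Theory.Digraph_Component"
    "Jordan_Normal_Form.Spectral_Radius"
begin

text \<open>
  A finite simple undirected graph is rendered as a \<^locale>\<open>pair_graph\<close>: a finite,
  loop-free, symmetric relation on a finite vertex set. Its arcs are the directed edges,
  each undirected edge being present in both orientations.
\<close>

text \<open>
  The matrices of \<^theory>\<open>Jordan_Normal_Form.Matrix\<close> are indexed by natural numbers, so the
  non-backtracking matrix is taken relative to an enumeration \<open>ds\<close> of the directed edges;
  row and column \<open>i\<close> belong to the directed edge \<open>ds ! i\<close>. The spectrum does not depend on
  the enumeration. The entries are complex because the spectral radius is a maximum
  over complex eigenvalues.
\<close>

definition nb_matrix :: "('a \<times> 'a) list \<Rightarrow> complex mat" where
  "nb_matrix ds = mat (length ds) (length ds)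
     (\<lambda>(i, j). case (ds ! i, ds ! j) of ((u\<^sub>1, v\<^sub>1), (u\<^sub>2, v\<^sub>2)) \<Rightarrow>
        if v\<^sub>1 = u\<^sub>2 \<and> u\<^sub>1 \<noteq> v\<^sub>2 then 1 else 0)"

text \<open>
  For an empty matrix \<^const>\<open>spectral_radius\<close> is the unspecified \<open>Max {}\<close>; its value is
  fixed to be 0 here, so that an edgeless graph has spectral radius 0.
\<close>

definition nb_spectral_radius :: "('a \<times> 'a) list \<Rightarrow> real" where
  "nb_spectral_radius ds = (if ds = [] then 0 else spectral_radius (nb_matrix ds))"

text \<open>
  The cycles of \<^theory>\<open>Graph_Theory.Arc_Walk\<close> are directed, so in a symmetric digraph
  every edge yields one of length 2. Length at least 3 singles out the cycles of the
  undirected graph.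
\<close>

definition graph_cycle :: "'a pair_pre_digraph \<Rightarrow> ('a \<times> 'a) list \<Rightarrow> bool" where
  "graph_cycle G p \<longleftrightarrow> pre_digraph.cycle (with_proj G) p \<and> 3 \<le> length p"

definition cycle_size :: "('a \<times> 'a) list \<Rightarrow> nat" where
  "cycle_size p = card (fst ` set p)"

definition edges :: "'a pair_pre_digraph \<Rightarrow> 'a set set" where
  "edges G = {{u, v} | u v. (u, v) \<in> parcs G}"

definition excess :: "'a pair_pre_digraph \<Rightarrow> int" where
  "excess G = int (card (edges G)) - int (card (pverts G))"

text \<open>
  A subgraph in the sense of \<^const>\<open>subgraph\<close> may contain only one orientation of
  an edge; requiring \<open>pair_graph H\<close> makes it a subgraph of the undirected graph.
\<close>

definition bicycle :: "'a pair_pre_digraph \<Rightarrow> 'a pair_pre_digraph \<Rightarrow> bool" where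
  "bicycle G H \<longleftrightarrow> pair_graph H \<and> subgraph (with_proj H) (with_proj G) \<and>
     Digraph_Component.connected (with_proj H) \<and> excess H = 1"

end

theory Submission
  imports Defs "Graph_Theory.Vertex_Walk"
begin

text \<open>
  Let \<open>A\<close> be the set of arcs. An eigenvector of the non-backtracking matrix for an eigenvalue of
  modulus \<open>\<rho>\<close> is a function on \<open>A\<close> whose value at \<open>(u, v)\<close>, times the eigenvalue, is the sum of
  its values at the arcs \<open>(v, w)\<close> with \<open>w \<noteq> u\<close>. At an arc where its modulus is maximal this
  forces at least \<open>\<rho> ^ k\<close> non-backtracking walks of every length \<open>k\<close> continuing that arc
  (\<open>many_nb_continuations\<close>). They all start at the same vertex. So if \<open>\<rho> ^ k > n\<close>, two of
  them also end at the same vertex, and if \<open>\<rho> ^ k > 2 * n\<close>, three of them do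
  (\<open>exists_parallel_nb_walks\<close>). The bounds of the theorem are \<open>2 * k\<close> and \<open>3 * k\<close> for the least
  natural numbers \<open>k\<close> with these properties.

  It remains to find a cycle in the union of two such walks and a bicycle in the union of three.
  Among all families of \<open>m\<close> distinct walks with common ends and common length choose one with
  least length \<open>k\<close>. Then the walks neither all begin nor all end with the same arc, as that
  arc could be removed; since they do not backtrack, every vertex of their union has degree at
  least \<open>2\<close> (\<open>two_neighbours\<close>). The union is connected and has at most
  \<open>2 + m * (k - 1) \<le> m * k\<close> vertices. For \<open>m = 2\<close> the minimum degree yields a cycle. For
  \<open>m = 3\<close> some vertex has degree at least \<open>3\<close>: in a graph with all degrees at most \<open>2\<close> a
  non-backtracking walk is determined by its length and its first arc, and there are at most
  two first arcs (\<open>three_neighbours\<close>). Hence the degree sum exceeds twice the number of vertices,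
  the excess is at least \<open>1\<close>, and a spanning tree together with two further edges is a bicycle.
  Choosing a shortest family avoids any analysis of how the walks overlap.
\<close>

section \<open>Non-backtracking walks and the spectral radius\<close>

definition nb_walk :: "('a \<times> 'a) set \<Rightarrow> 'a list \<Rightarrow> bool" where
  "nb_walk A xs \<longleftrightarrow>
     (\<forall>i. Suc i < length xs \<longrightarrow> (xs ! i, xs ! Suc i) \<in> A) \<and>
     (\<forall>i. Suc (Suc i) < length xs \<longrightarrow> xs ! i \<noteq> xs ! Suc (Suc i))"

lemma nb_walk_Cons_Cons:
  "nb_walk A (u # v # xs) \<longleftrightarrow>
     (u, v) \<in> A \<and> (xs \<noteq> [] \<longrightarrow> u \<noteq> hd xs) \<and> nb_walk A (v # xs)"
proof -
  have all_nat: "(\<forall>i. P i) \<longleftrightarrow> P 0 \<and> (\<forall>i. P (Suc i))" for P :: "nat \<Rightarrow> bool"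
    by (metis not0_implies_Suc)
  show ?thesis
    unfolding nb_walk_def
    by (subst all_nat, subst (2) all_nat) (auto simp: hd_conv_nth)
qed

lemma nb_walk_tl: "nb_walk A xs \<Longrightarrow> nb_walk A (tl xs)"
  unfolding nb_walk_def by (cases xs) auto

lemma nb_walk_butlast: "nb_walk A xs \<Longrightarrow> nb_walk A (butlast xs)"
  unfolding nb_walk_def by (auto simp: nth_butlast)

lemma nb_walk_verts:
  assumes "nb_walk A xs" "A \<subseteq> V \<times> V" "xs \<noteq> []" "hd xs \<in> V"
  shows "set xs \<subseteq> V"
proof
  fix x assume "x \<in> set xs"
  then obtain i where i: "i < length xs" "x = xs ! i" by (auto simp: in_set_conv_nth)
  show "x \<in> V"
  proof (cases i)
    case 0
    then show ?thesis using assms i by (simp add: hd_conv_nth)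
  next
    case (Suc j)
    then show ?thesis using assms i by (auto simp: nb_walk_def)
  qed
qed

text \<open>
  The walks that continue the arc \<open>(u, v)\<close> by \<open>k\<close> further arcs are listed from \<open>v\<close> on;
  \<open>u\<close> is kept only to forbid returning to it. So these are walks with \<open>k\<close> arcs that share the
  start \<open>v\<close>, and their number is the row sum of the \<open>k\<close>-th power of the non-backtracking
  matrix at \<open>(u, v)\<close>.
\<close>

definition nb_continuations :: "('a \<times> 'a) set \<Rightarrow> nat \<Rightarrow> 'a \<Rightarrow> 'a \<Rightarrow> 'a list set" where
  "nb_continuations A k u v = {xs. nb_walk A (u # xs) \<and> length xs = Suc k \<and> hd xs = v}"

lemma nb_continuations_0: "(u, v) \<in> A \<Longrightarrow> nb_continuations A 0 u v = {[v]}"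
  by (auto simp: nb_continuations_def length_Suc_conv nb_walk_Cons_Cons) (auto simp: nb_walk_def)

lemma nb_continuations_Suc:
  assumes "(u, v) \<in> A"
  shows "nb_continuations A (Suc k) u v =
    (\<Union>w\<in>{w. (v, w) \<in> A \<and> u \<noteq> w}. (#) v ` nb_continuations A k v w)"
proof (intro Set.set_eqI iffI)
  fix xs assume "xs \<in> nb_continuations A (Suc k) u v"
  then obtain w ys where "xs = v # w # ys" "length ys = k" "nb_walk A (u # v # w # ys)"
    by (auto simp: nb_continuations_def length_Suc_conv)
  then show "xs \<in> (\<Union>w\<in>{w. (v, w) \<in> A \<and> u \<noteq> w}. (#) v ` nb_continuations A k v w)"
    by (auto simp: nb_continuations_def nb_walk_Cons_Cons)
next
  fix xs assume "xs \<in> (\<Union>w\<in>{w. (v, w) \<in> A \<and> u \<noteq> w}. (#) v ` nb_continuations A k v w)"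
  then show "xs \<in> nb_continuations A (Suc k) u v"
    using assms by (auto simp: nb_continuations_def nb_walk_Cons_Cons)
qed

lemma finite_nb_continuations:
  assumes "finite A" "(u, v) \<in> A"
  shows "finite (nb_continuations A k u v)"
  using assms(2)
proof (induction k arbitrary: u v)
  case 0
  then show ?case by (simp add: nb_continuations_0)
next
  case (Suc k)
  have "finite {w. (v, w) \<in> A}"
    using finite_subset[of "{w. (v, w) \<in> A}" "snd ` A"] assms(1) by force
  then show ?case using Suc by (simp add: nb_continuations_Suc)
qed

lemma card_nb_continuations_Suc:
  assumes "finite A" "(u, v) \<in> A"
  shows "card (nb_continuations A (Suc k) u v) =
    (\<Sum>w\<in>{w. (v, w) \<in> A \<and> u \<noteq> w}. card (nb_continuations A k v w))"
proof -
  have fin: "finite {w. (v, w) \<in> A \<and> u \<noteq> w}"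
    using finite_subset[of "{w. (v, w) \<in> A \<and> u \<noteq> w}" "snd ` A"] assms(1) by force
  have "card (nb_continuations A (Suc k) u v) =
      (\<Sum>w\<in>{w. (v, w) \<in> A \<and> u \<noteq> w}. card ((#) v ` nb_continuations A k v w))"
    unfolding nb_continuations_Suc[OF assms(2)]
    using fin finite_nb_continuations[OF assms(1)]
    by (intro card_UN_disjoint) (auto simp: nb_continuations_def)
  then show ?thesis by (simp add: card_image)
qed

text \<open>
  Row sums of the \<open>k\<close>-th power bound the growth of an eigenvector. Unfolding the eigenvalue
  equation one arc at a time, and using the triangle inequality, gives this without matrix
  powers.
\<close>

lemma eigenfunction_growth:
  fixes f :: "'a \<times> 'a \<Rightarrow> complex"
  assumes fin: "finite A"
    and eig: "\<And>u v. (u, v) \<in> A \<Longrightarrow> c * f (u, v) = (\<Sum>w\<in>{w. (v, w) \<in> A \<and> u \<noteq> w}. f (v, w))"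
    and bound: "\<And>e. e \<in> A \<Longrightarrow> cmod (f e) \<le> M"
    and arc: "(u, v) \<in> A"
  shows "cmod c ^ k * cmod (f (u, v)) \<le> real (card (nb_continuations A k u v)) * M"
  using arc
proof (induction k arbitrary: u v)
  case 0
  then show ?case using bound by (simp add: nb_continuations_0)
next
  case (Suc k)
  let ?N = "{w. (v, w) \<in> A \<and> u \<noteq> w}"
  have "cmod c ^ Suc k * cmod (f (u, v)) = cmod c ^ k * cmod (c * f (u, v))"
    by (simp add: norm_mult)
  also have "\<dots> \<le> cmod c ^ k * (\<Sum>w\<in>?N. cmod (f (v, w)))"
    by (simp only: eig[OF Suc.prems]) (intro mult_left_mono norm_sum; simp)
  also have "\<dots> = (\<Sum>w\<in>?N. cmod c ^ k * cmod (f (v, w)))"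
    by (simp add: sum_distrib_left)
  also have "\<dots> \<le> (\<Sum>w\<in>?N. real (card (nb_continuations A k v w)) * M)"
    by (intro sum_mono Suc.IH) auto
  also have "\<dots> = real (card (nb_continuations A (Suc k) u v)) * M"
    by (simp add: card_nb_continuations_Suc[OF fin Suc.prems] sum_distrib_right)
  finally show ?case .
qed

text \<open>
  An eigenvector for an eigenvalue of maximal modulus, read as a function on arcs, so that the
  enumeration of the arcs disappears from the rest of the argument.
\<close>

lemma nb_eigenfunction:
  assumes "distinct ds" "set ds = A" "ds \<noteq> []"
  obtains c f where "cmod c = nb_spectral_radius ds"
    and "\<exists>e\<in>A. f e \<noteq> 0"
    and "\<And>u v. (u, v) \<in> A \<Longrightarrow> c * f (u, v) = (\<Sum>w\<in>{w. (v, w) \<in> A \<and> u \<noteq> w}. f (v, w))"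
proof -
  let ?N = "length ds" and ?B = "nb_matrix ds"
  have B: "?B \<in> carrier_mat ?N ?N" by (simp add: nb_matrix_def)
  have fin: "finite A" using assms by auto
  from spectral_radius_mem_max(1)[OF B] assms(3)
  obtain c where c: "c \<in> spectrum ?B" "cmod c = spectral_radius ?B"
    by auto
  then obtain x where "eigenvector ?B x c" by (auto simp: spectrum_def eigenvalue_def)
  then have x: "x \<in> carrier_vec ?N" "x \<noteq> 0\<^sub>v ?N" "?B *\<^sub>v x = c \<cdot>\<^sub>v x"
    using B by (auto simp: eigenvector_def)
  define f where "f e = x $ (THE i. i < ?N \<and> ds ! i = e)" for e
  have f_nth: "f (ds ! i) = x $ i" if "i < ?N" for i
    unfolding f_def using that assms(1)
    by (intro arg_cong[of _ _ "vec_index x"] the_equality) (auto simp: nth_eq_iff_index_eq)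
  have bij: "bij_betw ((!) ds) {..<?N} A"
    using assms by (intro bij_betw_nth) auto
  show thesis
  proof (rule that[of c f])
    show "cmod c = nb_spectral_radius ds" using c assms(3) by (simp add: nb_spectral_radius_def)
    obtain i where "i < ?N" "x $ i \<noteq> 0"
      using x(1,2) by (metis carrier_vecD eq_vecI index_zero_vec(1) index_zero_vec(2))
    then show "\<exists>e\<in>A. f e \<noteq> 0" using f_nth assms(2) by (metis nth_mem)
    fix u v assume "(u, v) \<in> A"
    then obtain i where i: "i < ?N" "ds ! i = (u, v)" using assms(2) by (metis in_set_conv_nth)
    let ?g = "\<lambda>e. (if v = fst e \<and> u \<noteq> snd e then f e else 0)"
    have "c * f (u, v) = (?B *\<^sub>v x) $ i"
      using i x f_nth[of i] by simp
    also have "\<dots> = (\<Sum>j<?N. ?B $$ (i, j) * x $ j)"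
      using i x(1) B by (auto simp: scalar_prod_def atLeast0LessThan intro!: sum.cong)
    also have "\<dots> = (\<Sum>j<?N. ?g (ds ! j))"
      using i by (intro sum.cong) (auto simp: nb_matrix_def f_nth split: prod.splits)
    also have "\<dots> = (\<Sum>e\<in>A. ?g e)" by (rule sum.reindex_bij_betw[OF bij])
    also have "\<dots> = (\<Sum>e\<in>{e\<in>A. v = fst e \<and> u \<noteq> snd e}. f e)"
      by (rule sum.inter_filter[OF fin, symmetric])
    also have "\<dots> = (\<Sum>w\<in>{w. (v, w) \<in> A \<and> u \<noteq> w}. f (v, w))"
      by (rule sum.reindex_bij_witness[of _ "Pair v" snd]) auto
    finally show "c * f (u, v) = (\<Sum>w\<in>{w. (v, w) \<in> A \<and> u \<noteq> w}. f (v, w))" .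
  qed
qed

text \<open>
  In \<open>eigenfunction_growth\<close> choose an arc at which the eigenfunction has its maximal modulus
  \<open>M > 0\<close>, and cancel \<open>M\<close>.
\<close>

lemma many_nb_continuations:
  assumes "distinct ds" "set ds = A" "ds \<noteq> []"
  obtains u v where "(u, v) \<in> A"
    and "nb_spectral_radius ds ^ k \<le> real (card (nb_continuations A k u v))"
proof -
  obtain c f where c: "cmod c = nb_spectral_radius ds" and ne: "\<exists>e\<in>A. f e \<noteq> 0"
    and eig: "\<And>u v. (u, v) \<in> A \<Longrightarrow> c * f (u, v) = (\<Sum>w\<in>{w. (v, w) \<in> A \<and> u \<noteq> w}. f (v, w))"
    by (rule nb_eigenfunction[OF assms]) blast
  have fin: "finite A" using assms by auto
  define M where "M = Max ((\<lambda>e. cmod (f e)) ` A)"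
  have bound: "cmod (f e) \<le> M" if "e \<in> A" for e
    unfolding M_def using fin that by auto
  have "M \<in> (\<lambda>e. cmod (f e)) ` A" unfolding M_def using fin ne by (intro Max_in) auto
  then obtain u v where uv: "(u, v) \<in> A" "M = cmod (f (u, v))" by auto
  have "M > 0" using ne bound by (metis zero_less_norm_iff order_less_le_trans)
  have "cmod c ^ k * M \<le> real (card (nb_continuations A k u v)) * M"
    using eigenfunction_growth[of A c f M u v k] fin eig bound uv by simp
  then show thesis using that[OF uv(1)] \<open>M > 0\<close> c by simp
qed

definition nb_walks :: "('a \<times> 'a) set \<Rightarrow> nat \<Rightarrow> 'a \<Rightarrow> 'a \<Rightarrow> 'a list set" where
  "nb_walks A k v w = {xs. nb_walk A xs \<and> length xs = Suc k \<and> hd xs = v \<and> last xs = w}"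

text \<open>
  Pigeonhole principle on the last vertex: more than \<open>m * card V\<close> walks from \<open>v\<close> end in
  \<open>card V\<close> vertices.
\<close>

lemma exists_parallel_nb_walks:
  assumes ds: "distinct ds" "set ds = A" "ds \<noteq> []"
    and V: "A \<subseteq> V \<times> V" "finite V"
    and large: "real (m * card V) < nb_spectral_radius ds ^ k"
  obtains W v w where "W \<subseteq> nb_walks A k v w" "card W = Suc m"
proof -
  have fin: "finite A" using ds by auto
  obtain u v where uv: "(u, v) \<in> A"
    and many: "nb_spectral_radius ds ^ k \<le> real (card (nb_continuations A k u v))"
    by (rule many_nb_continuations[OF ds]) blast
  let ?S = "nb_continuations A k u v"
  have finS: "finite ?S" by (rule finite_nb_continuations[OF fin uv])
  have "last xs \<in> V" if "xs \<in> ?S" for xs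
  proof -
    have "u \<in> V" using uv V by auto
    then have "set (u # xs) \<subseteq> V"
      using that V by (intro nb_walk_verts) (auto simp: nb_continuations_def)
    moreover have "xs \<noteq> []" using that by (auto simp: nb_continuations_def)
    ultimately show ?thesis by auto
  qed
  then have img: "last ` ?S \<subseteq> V" by auto
  have "\<exists>w\<in>V. Suc m \<le> card {xs\<in>?S. last xs = w}"
  proof (rule ccontr)
    assume "\<not> ?thesis"
    then have small: "\<And>w. w \<in> V \<Longrightarrow> card {xs\<in>?S. last xs = w} \<le> m" by force
    have "card ?S = (\<Sum>w\<in>V. card {xs\<in>?S. last xs = w})"
      using sum.group[OF finS V(2) img, of "\<lambda>_. 1::nat"] by simp
    also have "\<dots> \<le> m * card V" using sum_bounded_above[OF small] by (simp add: mult.commute)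
    finally have "real (card ?S) \<le> real (m * card V)" by (rule of_nat_mono)
    then show False using many large by linarith
  qed
  then obtain w W where W: "W \<subseteq> {xs\<in>?S. last xs = w}" "card W = Suc m"
    by (meson obtain_subset_with_card_n)
  have "W \<subseteq> nb_walks A k v w"
  proof
    fix xs assume "xs \<in> W"
    then have "nb_walk A (u # xs)" "length xs = Suc k" "hd xs = v" "last xs = w"
      using W(1) by (auto simp: nb_continuations_def)
    then show "xs \<in> nb_walks A k v w" using nb_walk_tl[of A "u # xs"] by (auto simp: nb_walks_def)
  qed
  then show thesis using that W(2) by blast
qed


section \<open>Edge sets, spanning trees and cycles\<close>

text \<open>
  Undirected graphs are given by their sets of edges, an edge being a two-element set. In this
  form a subgraph is just a subset.
\<close>

definition nbrs :: "'a set set \<Rightarrow> 'a \<Rightarrow> 'a set" where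
  "nbrs E x = {y. {x, y} \<in> E}"

definition adj :: "'a set set \<Rightarrow> 'a rel" where
  "adj E = {(x, y). {x, y} \<in> E}"

text \<open>
  Double counting of the pairs of a vertex and an edge that contains it.
\<close>

lemma handshake:
  assumes fin: "finite V"
    and E: "\<And>e. e \<in> E \<Longrightarrow> \<exists>x y. e = {x, y} \<and> x \<noteq> y \<and> x \<in> V \<and> y \<in> V"
  shows "(\<Sum>x\<in>V. card (nbrs E x)) = 2 * card E"
proof -
  have "E \<subseteq> Pow V" using E by fast
  then have finE: "finite E" using fin by (simp add: finite_subset)
  have "card (nbrs E x) = card {e\<in>E. x \<in> e}" for x
  proof -
    have "bij_betw (\<lambda>y. {x, y}) (nbrs E x) {e\<in>E. x \<in> e}"
      unfolding bij_betw_def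
    proof
      show "inj_on (\<lambda>y. {x, y}) (nbrs E x)" by (auto simp: inj_on_def doubleton_eq_iff)
      have "e \<in> (\<lambda>y. {x, y}) ` nbrs E x" if "e \<in> E" "x \<in> e" for e
      proof -
        from E[OF that(1)] that(2) obtain y where "e = {x, y}" by blast
        then show ?thesis using that(1) by (auto simp: nbrs_def)
      qed
      then show "(\<lambda>y. {x, y}) ` nbrs E x = {e\<in>E. x \<in> e}" by (auto simp: nbrs_def)
    qed
    then show ?thesis by (rule bij_betw_same_card)
  qed
  then have "(\<Sum>x\<in>V. card (nbrs E x)) = (\<Sum>x\<in>V. \<Sum>e\<in>{e\<in>E. x \<in> e}. 1)" by simp
  also have "\<dots> = (\<Sum>e\<in>E. \<Sum>x\<in>{x\<in>V. x \<in> e}. 1)"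
    by (rule sum.swap_restrict[OF fin finE])
  also have "\<dots> = (\<Sum>e\<in>E. 2)"
  proof (rule sum.cong[OF refl])
    fix e assume "e \<in> E"
    then obtain x y where e: "e = {x, y}" "x \<noteq> y" "x \<in> V" "y \<in> V" using E by blast
    then have "{x\<in>V. x \<in> e} = {x, y}" by auto
    then show "(\<Sum>x\<in>{x\<in>V. x \<in> e}. 1) = (2::nat)" using e(2) by simp
  qed
  finally show ?thesis by simp
qed

lemma rtrancl_leaves:
  assumes "(v, x) \<in> R\<^sup>*" "v \<in> S" "x \<notin> S"
  obtains a b where "(a, b) \<in> R" "a \<in> S" "b \<notin> S"
  using assms by (induction rule: rtrancl_induct) blast+

lemma adj_mono: "T \<subseteq> E \<Longrightarrow> (adj T)\<^sup>* \<subseteq> (adj E)\<^sup>*"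
  by (intro rtrancl_mono) (auto simp: adj_def)

text \<open>
  The tree is grown from \<open>v\<close>: as long as its vertex set \<open>S\<close> is not all of \<open>V\<close>, a path to a
  vertex outside leaves \<open>S\<close> along an edge, which is added together with its new endpoint.
  Only the number of edges and the connectedness of the result are recorded, not acyclicity.
\<close>

lemma spanning_tree_exists:
  assumes fin: "finite V" and "v \<in> V"
    and E: "\<And>x y. {x, y} \<in> E \<Longrightarrow> x \<in> V \<and> y \<in> V"
    and conn: "\<And>x. x \<in> V \<Longrightarrow> (v, x) \<in> (adj E)\<^sup>*"
  obtains T where "T \<subseteq> E" "Suc (card T) = card V" "\<And>x. x \<in> V \<Longrightarrow> (v, x) \<in> (adj T)\<^sup>*"
proof -
  have grow: "\<exists>S T. v \<in> S \<and> S \<subseteq> V \<and> card S = Suc n \<and> T \<subseteq> E \<and> finite T \<and> card T = n \<and> \<Union>T \<subseteq> S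
      \<and> (\<forall>x\<in>S. (v, x) \<in> (adj T)\<^sup>*)" if "n < card V" for n
    using that
  proof (induction n)
    case 0
    then show ?case using \<open>v \<in> V\<close> by (intro exI[of _ "{v}"] exI[of _ "{}"]) auto
  next
    case (Suc n)
    then obtain S T where ST: "v \<in> S" "S \<subseteq> V" "card S = Suc n" "T \<subseteq> E" "finite T" "card T = n"
      "\<Union>T \<subseteq> S" and reach: "\<And>x. x \<in> S \<Longrightarrow> (v, x) \<in> (adj T)\<^sup>*"
      by (metis Suc_lessD)
    have "S \<noteq> V" using ST(3) Suc.prems by auto
    then obtain x where "x \<in> V" "x \<notin> S" using ST(2) by blast
    then obtain a b where ab: "{a, b} \<in> E" "a \<in> S" "b \<notin> S"
      using rtrancl_leaves[OF conn[OF \<open>x \<in> V\<close>] ST(1)] by (auto simp: adj_def)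
    let ?T = "insert {a, b} T"
    have sub: "(adj T)\<^sup>* \<subseteq> (adj ?T)\<^sup>*" by (rule adj_mono) auto
    have "(v, a) \<in> (adj ?T)\<^sup>*" using reach[OF ab(2)] sub by auto
    moreover have "(a, b) \<in> adj ?T" by (auto simp: adj_def)
    ultimately have "(v, b) \<in> (adj ?T)\<^sup>*" by (rule rtrancl_into_rtrancl)
    moreover have "{a, b} \<notin> T" using ST(7) ab by auto
    moreover have "finite S" using ST(2) fin by (rule finite_subset)
    ultimately show ?case
      using ST ab E[OF ab(1)] reach sub
      by (intro exI[of _ "insert b S"] exI[of _ ?T]) auto
  qed
  have "card V > 0" using fin \<open>v \<in> V\<close> by (auto simp: card_gt_0_iff)
  then obtain n where n: "card V = Suc n" by (cases "card V") auto
  then obtain S T where ST: "S \<subseteq> V" "card S = Suc n" "T \<subseteq> E" "card T = n"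
      and reach: "\<And>x. x \<in> S \<Longrightarrow> (v, x) \<in> (adj T)\<^sup>*"
    using grow[of n] by auto
  then have "S = V" using n fin by (simp add: card_subset_eq)
  then show thesis using that[of T] ST n reach by simp
qed

text \<open>
  A spanning tree stays connected when edges are added, so every edge number between that of the
  tree and that of the graph is attained. This turns a subgraph of excess at least \<open>1\<close>
  into one of excess exactly \<open>1\<close> on the same vertices.
\<close>

lemma trim_connected_edge_set:
  assumes fin: "finite V" and "v \<in> V"
    and E: "\<And>x y. {x, y} \<in> E \<Longrightarrow> x \<in> V \<and> y \<in> V" "finite E"
    and conn: "\<And>x. x \<in> V \<Longrightarrow> (v, x) \<in> (adj E)\<^sup>*"
    and "card V \<le> c" "c \<le> card E"
  obtains F where "F \<subseteq> E" "card F = c" "\<And>x. x \<in> V \<Longrightarrow> (v, x) \<in> (adj F)\<^sup>*"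
proof -
  obtain T where T: "T \<subseteq> E" "Suc (card T) = card V" "\<And>x. x \<in> V \<Longrightarrow> (v, x) \<in> (adj T)\<^sup>*"
    using spanning_tree_exists[OF assms(1-3,5)] by blast
  obtain F where "T \<subseteq> F" "F \<subseteq> E" "card F = c"
    using exists_subset_between[of T c E] T assms by auto
  then show thesis using that[of F] T(3) adj_mono[of T F] by blast
qed

text \<open>
  All neighbours of the first vertex of a longest path lie on the path. One of them is not its
  successor on the path; the path up to that neighbour closes to a cycle through at least three
  vertices.
\<close>

lemma long_cycle_of_min_degree_two:
  assumes fin: "finite V" "V \<noteq> {}"
    and R: "sym R" "irrefl R" "R \<subseteq> V \<times> V"
    and deg: "\<And>x. x \<in> V \<Longrightarrow> \<exists>a b. a \<noteq> b \<and> (x, a) \<in> R \<and> (x, b) \<in> R"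
  obtains xs where "distinct xs" "3 \<le> length xs" "set xs \<subseteq> V"
    "successively (\<lambda>x y. (x, y) \<in> R) xs" "(last xs, hd xs) \<in> R"
proof -
  define P where "P xs \<longleftrightarrow> xs \<noteq> [] \<and> distinct xs \<and> set xs \<subseteq> V \<and> successively (\<lambda>x y. (x, y) \<in> R) xs"
    for xs
  obtain x0 where "x0 \<in> V" using fin by auto
  then have "P [x0]" by (auto simp: P_def)
  moreover have "length xs < Suc (card V)" if "P xs" for xs
    using that fin by (auto simp: P_def less_Suc_eq_le card_mono simp flip: distinct_card)
  ultimately obtain xs where xs: "P xs" and longest: "\<And>ys. P ys \<Longrightarrow> length ys \<le> length xs"
    using ex_has_greatest_nat[of P "[x0]" length "Suc (card V)"] by (metis less_imp_le)
  then obtain x zs where xzs: "xs = x # zs" by (cases xs) (auto simp: P_def)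
  \<comment> \<open>otherwise the path could be prolonged at its front\<close>
  have on_path: "a \<in> set zs" if "(x, a) \<in> R" for a
  proof (rule ccontr)
    assume "a \<notin> set zs"
    moreover have "a \<noteq> x" "(a, x) \<in> R" "a \<in> V" using that R by (auto simp: irrefl_def sym_def)
    ultimately have "P (a # xs)" using xs xzs by (auto simp: P_def successively_Cons)
    then show False using longest[of "a # xs"] by simp
  qed
  have "x \<in> V" using xs xzs by (auto simp: P_def)
  then obtain a b where ab: "a \<noteq> b" "(x, a) \<in> R" "(x, b) \<in> R" using deg by blast
  have "\<exists>j. 0 < j \<and> j < length zs \<and> (x, zs ! j) \<in> R"
  proof -
    obtain i j where "i < length zs" "zs ! i = a" "j < length zs" "zs ! j = b"
      using on_path ab by (metis in_set_conv_nth)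
    then show ?thesis using ab by (metis gr0I)
  qed
  then obtain j where j: "0 < j" "j < length zs" "(x, zs ! j) \<in> R" by blast
  define ys where "ys = x # take (Suc j) zs"
  have ys: "ys = take (Suc (Suc j)) xs" by (simp add: ys_def xzs)
  have "last ys = zs ! j" using j by (simp add: ys_def take_Suc_conv_app_nth)
  then have "(last ys, hd ys) \<in> R" using j(3) R(1) by (auto simp: ys_def sym_def)
  moreover have "successively (\<lambda>x y. (x, y) \<in> R) ys"
    using xs append_take_drop_id[of "Suc (Suc j)" xs] unfolding ys P_def
    by (metis successively_append_iff)
  moreover have "set ys \<subseteq> V" "distinct ys"
    using xs set_take_subset[of "Suc (Suc j)" xs] by (auto simp: ys P_def)
  moreover have "3 \<le> length ys" using j by (simp add: ys_def)
  ultimately show thesis using that by blast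
qed

section \<open>The union of parallel non-backtracking walks\<close>

text \<open>
  A family of at least two walks with the same ends and the same number \<open>k\<close> of arcs, where no
  equally large family has fewer arcs. The point of minimality is that the walks do not all
  begin with the same arc and do not all end with the same arc, since such an arc could be cut
  off. Hence their union has no vertex of degree \<open>1\<close>.
\<close>

locale minimal_parallel_nb_walks =
  fixes A :: "('a \<times> 'a) set" and W :: "'a list set" and k :: nat and v w :: 'a
  assumes sym: "sym A" and irrefl: "irrefl A"
    and walks: "W \<subseteq> nb_walks A k v w"
    and two: "2 \<le> card W"
    and minimal: "\<And>j W' v' w'. W' \<subseteq> nb_walks A j v' w' \<Longrightarrow> card W' = card W \<Longrightarrow> k \<le> j"
begin

definition V :: "'a set" where
  "V = \<Union> (set ` W)"

definition E :: "'a set set" where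
  "E = {{xs ! i, xs ! Suc i} | xs i. xs \<in> W \<and> i < k}"

lemma finite_W: "finite W"
  using two by (auto intro: card_ge_0_finite)

lemma finite_V: "finite V"
  using finite_W by (auto simp: V_def)

lemma walk:
  assumes "xs \<in> W"
  shows "nb_walk A xs" "length xs = Suc k" "xs ! 0 = v" "xs ! k = w"
proof -
  have "nb_walk A xs \<and> length xs = Suc k \<and> hd xs = v \<and> last xs = w"
    using assms walks by (auto simp: nb_walks_def)
  moreover from this have "xs \<noteq> []" by auto
  ultimately show "nb_walk A xs" "length xs = Suc k" "xs ! 0 = v" "xs ! k = w"
    by (auto simp: hd_conv_nth last_conv_nth)
qed

lemma edgeI: "xs \<in> W \<Longrightarrow> i < k \<Longrightarrow> {xs ! i, xs ! Suc i} \<in> E"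
  by (auto simp: E_def)

lemma edgeD:
  assumes "{x, y} \<in> E"
  shows "x \<in> V" "y \<in> V" "x \<noteq> y" "(x, y) \<in> A"
proof -
  obtain xs i where xs: "xs \<in> W" "i < k" "{x, y} = {xs ! i, xs ! Suc i}"
    using assms by (auto simp: E_def)
  then have "(xs ! i, xs ! Suc i) \<in> A" using walk[of xs] by (auto simp: nb_walk_def)
  moreover from this have "(xs ! Suc i, xs ! i) \<in> A" using sym by (auto simp: sym_def)
  ultimately show A: "(x, y) \<in> A" using xs(3) by (auto simp: doubleton_eq_iff)
  then show "x \<noteq> y" using irrefl by (auto simp: irrefl_def)
  have "xs ! i \<in> set xs" "xs ! Suc i \<in> set xs" using xs walk[of xs] by auto
  then show "x \<in> V" "y \<in> V" using xs by (auto simp: V_def doubleton_eq_iff)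
qed

lemma edge_doubleton: "e \<in> E \<Longrightarrow> \<exists>x y. e = {x, y} \<and> x \<noteq> y \<and> x \<in> V \<and> y \<in> V"
  using edgeD by (auto simp: E_def) blast

lemma finite_E: "finite E"
proof -
  have "E \<subseteq> Pow V" using edge_doubleton by fast
  then show ?thesis using finite_V by (simp add: finite_subset)
qed

lemma k_pos: "0 < k"
proof (rule ccontr)
  assume "\<not> 0 < k"
  then have "W \<subseteq> {[v]}" using walk by (fastforce simp: length_Suc_conv)
  then show False using two card_mono[of "{[v]}" W] by simp
qed

text \<open>
  Otherwise the walks without their first vertex form a family of the same size with
  \<open>k - 1\<close> arcs.
\<close>

lemma first_steps_differ: "\<exists>xs\<in>W. \<exists>ys\<in>W. xs ! 1 \<noteq> ys ! 1"
proof (rule ccontr)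
  assume same: "\<not> ?thesis"
  obtain zs where zs: "zs \<in> W" using two by fastforce
  have "inj_on tl W"
  proof (rule inj_onI)
    fix xs ys assume "xs \<in> W" "ys \<in> W" "tl xs = tl ys"
    moreover from this have "hd xs = hd ys" "xs \<noteq> []" "ys \<noteq> []"
      using walks by (auto simp: nb_walks_def)
    ultimately show "xs = ys" by (metis list.collapse)
  qed
  then have "card (tl ` W) = card W" by (rule card_image)
  moreover have "tl ` W \<subseteq> nb_walks A (k - 1) (zs ! 1) w"
  proof
    fix ys assume "ys \<in> tl ` W"
    then obtain xs where xs: "xs \<in> W" "ys = tl xs" by auto
    then have len: "length ys = k" using walk(2) by simp
    then have "ys \<noteq> []" using k_pos by auto
    have "hd ys = zs ! 1"
    proof -
      have "hd ys = xs ! 1" using hd_conv_nth[OF \<open>ys \<noteq> []\<close>] xs(2) len k_pos nth_tl[of 0 xs] by simp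
      moreover have "xs ! 1 = zs ! 1" using same xs(1) zs by blast
      ultimately show ?thesis by simp
    qed
    have "last ys = last xs" using xs(2) \<open>ys \<noteq> []\<close> by (cases xs) auto
    moreover have "last xs = w" using xs(1) walks by (auto simp: nb_walks_def)
    moreover have "nb_walk A ys" unfolding xs(2) by (intro nb_walk_tl walk(1) xs(1))
    ultimately show "ys \<in> nb_walks A (k - 1) (zs ! 1) w"
      using len k_pos \<open>hd ys = zs ! 1\<close> by (simp add: nb_walks_def)
  qed
  ultimately have "k \<le> k - 1" by (intro minimal)
  then show False using k_pos by simp
qed

text \<open>
  As \<open>first_steps_differ\<close>, at the other end of the walks.
\<close>

lemma last_steps_differ: "\<exists>xs\<in>W. \<exists>ys\<in>W. xs ! (k - 1) \<noteq> ys ! (k - 1)"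
proof (rule ccontr)
  assume same: "\<not> ?thesis"
  obtain zs where zs: "zs \<in> W" using two by fastforce
  have "inj_on butlast W"
  proof (rule inj_onI)
    fix xs ys assume "xs \<in> W" "ys \<in> W" "butlast xs = butlast ys"
    moreover from this have "last xs = last ys" "xs \<noteq> []" "ys \<noteq> []"
      using walks by (auto simp: nb_walks_def)
    ultimately show "xs = ys" by (metis append_butlast_last_id)
  qed
  then have "card (butlast ` W) = card W" by (rule card_image)
  moreover have "butlast ` W \<subseteq> nb_walks A (k - 1) v (zs ! (k - 1))"
  proof
    fix ys assume "ys \<in> butlast ` W"
    then obtain xs where xs: "xs \<in> W" "ys = butlast xs" by auto
    then have len: "length ys = k" using walk(2) by simp
    then have "ys \<noteq> []" using k_pos by auto
    have "last ys = zs ! (k - 1)"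
    proof -
      have "last ys = xs ! (k - 1)"
        using xs len k_pos \<open>ys \<noteq> []\<close> by (simp add: last_conv_nth nth_butlast)
      moreover have "xs ! (k - 1) = zs ! (k - 1)" using same xs(1) zs by blast
      ultimately show ?thesis by simp
    qed
    moreover have "hd ys = v"
      using xs \<open>ys \<noteq> []\<close> len k_pos walk[OF xs(1)] by (simp add: hd_conv_nth nth_butlast)
    moreover have "nb_walk A ys" unfolding xs(2) by (intro nb_walk_butlast walk(1) xs(1))
    ultimately show "ys \<in> nb_walks A (k - 1) v (zs ! (k - 1))"
      using len k_pos \<open>last ys = zs ! (k - 1)\<close> by (simp add: nb_walks_def)
  qed
  ultimately have "k \<le> k - 1" by (intro minimal)
  then show False using k_pos by simp
qed

lemma vertexE:
  assumes "x \<in> V"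
  obtains xs i where "xs \<in> W" "i \<le> k" "x = xs ! i"
proof -
  from assms obtain xs i where xs: "xs \<in> W" "i < length xs" "x = xs ! i"
    by (auto simp: V_def in_set_conv_nth)
  then show thesis using that[of xs i] walk(2)[of xs] by simp
qed

text \<open>
  At an inner vertex of a walk these are its predecessor and its successor, which differ because
  the walk does not backtrack. At the common ends they come from two walks that differ in their
  first, respectively last, arc.
\<close>

lemma two_neighbours:
  assumes "x \<in> V"
  shows "\<exists>a b. a \<noteq> b \<and> {x, a} \<in> E \<and> {x, b} \<in> E"
proof -
  obtain xs i where xs: "xs \<in> W" "i \<le> k" "x = xs ! i" using assms by (rule vertexE)
  consider "i = 0" | "i = k" | "0 < i" "i < k" using xs(2) by linarith
  then show ?thesis
  proof cases
    case 1
    obtain ys zs where "ys \<in> W" "zs \<in> W" "ys ! 1 \<noteq> zs ! 1" using first_steps_differ by blast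
    moreover from this have "{v, ys ! 1} \<in> E" "{v, zs ! 1} \<in> E"
      using edgeI[of ys 0] edgeI[of zs 0] k_pos walk(3) by auto
    ultimately show ?thesis using 1 xs walk(3) by auto
  next
    case 2
    obtain ys zs where "ys \<in> W" "zs \<in> W" "ys ! (k - 1) \<noteq> zs ! (k - 1)"
      using last_steps_differ by blast
    moreover from this have "{w, ys ! (k - 1)} \<in> E" "{w, zs ! (k - 1)} \<in> E"
      using edgeI[of ys "k - 1"] edgeI[of zs "k - 1"] k_pos walk(4)
      by (auto simp: insert_commute)
    ultimately show ?thesis using 2 xs walk(4) by auto
  next
    case 3
    then obtain j where j: "i = Suc j" by (cases i) auto
    then have "xs ! j \<noteq> xs ! Suc i"
      using walk[OF xs(1)] 3 by (auto simp: nb_walk_def)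
    moreover have "{x, xs ! j} \<in> E" "{x, xs ! Suc i} \<in> E"
      using edgeI[OF xs(1), of j] edgeI[OF xs(1), of i] 3 j xs(3) by (auto simp: insert_commute)
    ultimately show ?thesis by blast
  qed
qed

lemma start_in_V: "v \<in> V"
proof -
  obtain xs where "xs \<in> W" using two by fastforce
  then show ?thesis using walk[of xs] nth_mem[of 0 xs] by (auto simp: V_def)
qed

lemma reachable_from_start:
  assumes "x \<in> V"
  shows "(v, x) \<in> (adj E)\<^sup>*"
proof -
  obtain xs i where xs: "xs \<in> W" "i \<le> k" "x = xs ! i" using assms by (rule vertexE)
  have "(v, xs ! i) \<in> (adj E)\<^sup>*" using xs(2)
  proof (induction i)
    case 0
    then show ?case using walk(3)[OF xs(1)] by simp
  next
    case (Suc i)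
    then have "(xs ! i, xs ! Suc i) \<in> adj E" using edgeI[OF xs(1)] by (auto simp: adj_def)
    then show ?case using Suc by (auto intro: rtrancl_into_rtrancl)
  qed
  then show ?thesis using xs(3) by simp
qed

text \<open>
  Each walk has at most \<open>k - 1\<close> inner vertices. The bound grants it \<open>k\<close> vertices, and as there
  are at least two walks, the spare ones account for the two common ends.
\<close>

lemma card_V_le: "card V \<le> card W * k"
proof -
  let ?inner = "\<Union>xs\<in>W. (!) xs ` {1..<k}"
  have "V \<subseteq> {v, w} \<union> ?inner"
  proof
    fix x assume "x \<in> V"
    then obtain xs i where xs: "xs \<in> W" "i \<le> k" "x = xs ! i" by (rule vertexE)
    consider "i = 0" | "i = k" | "i \<in> {1..<k}" using xs(2) by fastforce
    then show "x \<in> {v, w} \<union> ?inner"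
    proof cases
      case 3
      then have "x \<in> (!) xs ` {1..<k}" unfolding xs(3) by (rule imageI)
      then show ?thesis using xs(1) by (intro UnI2 UN_I)
    qed (use xs walk(3,4)[OF xs(1)] in simp_all)
  qed
  then have "card V \<le> card ({v, w} \<union> ?inner)" using finite_W by (intro card_mono) auto
  also have "\<dots> \<le> card {v, w} + card ?inner" by (rule card_Un_le)
  also have "\<dots> \<le> 2 + (\<Sum>xs\<in>W. card ((!) xs ` {1..<k}))"
    by (intro add_mono card_UN_le finite_W) (simp add: card_insert_if)
  also have "\<dots> \<le> 2 + (\<Sum>xs\<in>W. k - 1)"
    by (intro add_left_mono sum_mono order_trans[OF card_image_le]) auto
  also have "\<dots> = 2 + card W * (k - 1)" by simp
  also have "\<dots> \<le> card W + card W * (k - 1)" using two by simp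
  also have "\<dots> = card W * k" using k_pos by (cases k) auto
  finally show ?thesis .
qed

lemma finite_nbrs: "finite (nbrs E x)"
  by (rule finite_subset[OF _ finite_V]) (auto simp: nbrs_def dest: edgeD)

lemma two_le_card_nbrs:
  assumes "x \<in> V"
  shows "2 \<le> card (nbrs E x)"
proof -
  obtain a b where "a \<noteq> b" "{a, b} \<subseteq> nbrs E x"
    using two_neighbours[OF assms] by (auto simp: nbrs_def)
  then show ?thesis using card_mono[OF finite_nbrs, of "{a, b}" x] by simp
qed

text \<open>
  At a vertex of degree at most \<open>2\<close> a walk that must not turn back has at most one way to go on.
\<close>

lemma walk_determined_by_first_step:
  assumes deg: "\<And>x. x \<in> V \<Longrightarrow> card (nbrs E x) \<le> 2"
    and xs: "xs \<in> W" and ys: "ys \<in> W" and first: "xs ! 1 = ys ! 1"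
  shows "xs = ys"
proof -
  have "i < k \<longrightarrow> xs ! i = ys ! i \<and> xs ! Suc i = ys ! Suc i" for i
  proof (induction i)
    case 0
    then show ?case using first walk(3) xs ys by auto
  next
    case (Suc i)
    show ?case
    proof
      assume i: "Suc i < k"
      with Suc have eq: "xs ! i = ys ! i" "xs ! Suc i = ys ! Suc i" by auto
      let ?x = "xs ! Suc i"
      have "?x \<in> V" using xs i walk(2)[OF xs] by (auto simp: V_def intro!: bexI[of _ xs])
      have nb: "xs ! i \<noteq> xs ! Suc (Suc i)" "ys ! i \<noteq> ys ! Suc (Suc i)"
        using walk[OF xs] walk[OF ys] i by (auto simp: nb_walk_def)
      have "xs ! i \<in> nbrs E ?x" "xs ! Suc (Suc i) \<in> nbrs E ?x" "ys ! Suc (Suc i) \<in> nbrs E ?x"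
        using edgeI[OF xs, of i] edgeI[OF xs, of "Suc i"] edgeI[OF ys, of "Suc i"] i eq
        by (auto simp: nbrs_def insert_commute)
      then have sub: "{xs ! i, xs ! Suc (Suc i), ys ! Suc (Suc i)} \<subseteq> nbrs E ?x" by auto
      have "xs ! Suc (Suc i) = ys ! Suc (Suc i)"
      proof (rule ccontr)
        assume "\<not> ?thesis"
        then have "card {xs ! i, xs ! Suc (Suc i), ys ! Suc (Suc i)} = 3"
          using nb eq by auto
        then show False using card_mono[OF finite_nbrs sub] deg[OF \<open>?x \<in> V\<close>] by simp
      qed
      then show "xs ! Suc i = ys ! Suc i \<and> xs ! Suc (Suc i) = ys ! Suc (Suc i)" using eq by simp
    qed
  qed
  then have "xs ! i = ys ! i" if "i < Suc k" for i
    using that k_pos walk(4) xs ys by (cases "i = k") auto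
  then show ?thesis using walk(2) xs ys by (intro nth_equalityI) auto
qed

text \<open>
  If all degrees were at most \<open>2\<close>, a walk would be determined by its first step, for which
  there are at most two choices.
\<close>

lemma three_neighbours:
  assumes "3 \<le> card W"
  shows "\<exists>x\<in>V. 3 \<le> card (nbrs E x)"
proof (rule ccontr)
  assume "\<not> ?thesis"
  then have deg: "\<And>x. x \<in> V \<Longrightarrow> card (nbrs E x) \<le> 2" by force
  have "inj_on (\<lambda>xs. xs ! 1) W"
    by (rule inj_onI) (rule walk_determined_by_first_step[OF deg])
  moreover have "(\<lambda>xs. xs ! 1) ` W \<subseteq> nbrs E v"
    using edgeI[of _ 0] k_pos walk(3) by (auto simp: nbrs_def)
  ultimately have "card W \<le> card (nbrs E v)" using finite_nbrs by (rule card_inj_on_le)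
  then show False using deg[OF start_in_V] assms by simp
qed

text \<open>
  All degrees are at least \<open>2\<close> and one is larger, so the degree sum \<open>2 * card E\<close> exceeds
  \<open>2 * card V\<close>.
\<close>

lemma card_V_less_card_E:
  assumes "3 \<le> card W"
  shows "card V < card E"
proof -
  obtain x where x: "x \<in> V" "3 \<le> card (nbrs E x)" using three_neighbours[OF assms] by blast
  have "2 * card V = (\<Sum>y\<in>V. 2)" by simp
  also have "\<dots> < (\<Sum>y\<in>V. card (nbrs E y))"
    using finite_V two_le_card_nbrs x by (intro sum_strict_mono_ex1) force+
  also have "\<dots> = 2 * card E" using finite_V edge_doubleton by (rule handshake)
  finally show ?thesis by simp
qed

end

lemma exists_minimal_parallel_nb_walks:
  assumes "sym A" "irrefl A" "W \<subseteq> nb_walks A k v w" "2 \<le> card W"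
  obtains W' j v' w' where "minimal_parallel_nb_walks A W' j v' w'" "card W' = card W" "j \<le> k"
proof -
  define P where "P j \<longleftrightarrow> (\<exists>W' v' w'. W' \<subseteq> nb_walks A j v' w' \<and> card W' = card W)" for j
  have "P k" using assms by (auto simp: P_def)
  then have "P (LEAST j. P j)" "(LEAST j. P j) \<le> k" by (rule LeastI, rule Least_le)
  then obtain W' v' w' where W': "W' \<subseteq> nb_walks A (LEAST j. P j) v' w'" "card W' = card W"
    by (auto simp: P_def)
  have "minimal_parallel_nb_walks A W' (LEAST j. P j) v' w'"
  proof
    fix j W'' v'' w'' assume "W'' \<subseteq> nb_walks A j v'' w''" "card W'' = card W'"
    then have "P j" using W'(2) by (auto simp: P_def)
    then show "(LEAST j. P j) \<le> j" by (rule Least_le)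
  qed (use assms W' in auto)
  then show thesis using that W'(2) \<open>_ \<le> k\<close> by blast
qed


section \<open>Cycles and bicycles in symmetric digraphs\<close>

lemma pcas_vwalk_arcs: "xs \<noteq> [] \<Longrightarrow> pcas (hd xs) (vwalk_arcs xs) (last xs)"
  by (induction xs rule: vwalk_arcs.induct) auto

lemma pawalk_verts_vwalk_arcs: "xs \<noteq> [] \<Longrightarrow> pawalk_verts (hd xs) (vwalk_arcs xs) = xs"
  by (induction xs rule: vwalk_arcs.induct) auto

lemma vwalk_arcs_subset: "successively (\<lambda>x y. (x, y) \<in> R) xs \<Longrightarrow> set (vwalk_arcs xs) \<subseteq> R"
  by (induction xs rule: vwalk_arcs.induct) auto

lemma fst_vwalk_arcs: "fst ` set (vwalk_arcs xs) = set (butlast xs)"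
  by (induction xs rule: vwalk_arcs.induct) auto

text \<open>
  A cycle is a list of arcs, obtained from its vertices by repeating the first one at the end.
\<close>

lemma graph_cycle_of_vertex_list:
  assumes "pair_graph G" "distinct xs" "3 \<le> length xs"
    "successively (\<lambda>x y. (x, y) \<in> parcs G) xs" "(last xs, hd xs) \<in> parcs G"
  shows "graph_cycle G (vwalk_arcs (xs @ [hd xs]))"
    and "cycle_size (vwalk_arcs (xs @ [hd xs])) = length xs"
proof -
  interpret pair_graph G by fact
  let ?p = "vwalk_arcs (xs @ [hd xs])"
  have ne: "xs \<noteq> []" using assms(3) by auto
  have arcs: "set ?p \<subseteq> parcs G"
    using assms(4,5) ne by (intro vwalk_arcs_subset) (auto simp: successively_append_iff)
  have "hd xs \<in> pverts G" using assms(5) by (rule in_arcsD2)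
  moreover have "pcas (hd xs) ?p (hd xs)" using pcas_vwalk_arcs[of "xs @ [hd xs]"] ne by simp
  moreover have "pawalk_verts (hd xs) ?p = xs @ [hd xs]"
    using pawalk_verts_vwalk_arcs[of "xs @ [hd xs]"] ne by simp
  moreover have "distinct (tl (xs @ [hd xs]))" using assms(2) ne by (cases xs) auto
  moreover have len: "length ?p = length xs"
    using vwalk_length_simp[of "xs @ [hd xs]"] unfolding vwalk_length_def by simp
  ultimately show "graph_cycle G ?p"
    using arcs assms(3) unfolding graph_cycle_def cycle_def awalk_def
    by (auto intro!: exI[of _ "hd xs"])
  show "cycle_size ?p = length xs"
    using assms(2) by (simp add: cycle_size_def fst_vwalk_arcs distinct_card)
qed

text \<open>
  The subgraph has to contain each edge in both orientations, which is what \<^const>\<open>adj\<close> yields.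
\<close>

lemma bicycle_of_edge_set:
  assumes G: "pair_graph G"
    and V: "finite V" "v \<in> V"
    and F: "\<And>e. e \<in> F \<Longrightarrow> \<exists>x y. e = {x, y} \<and> x \<noteq> y \<and> x \<in> V \<and> y \<in> V"
    and sub: "V \<subseteq> pverts G" "adj F \<subseteq> parcs G"
    and card: "card F = Suc (card V)"
    and conn: "\<And>x. x \<in> V \<Longrightarrow> (v, x) \<in> (adj F)\<^sup>*"
  shows "bicycle G \<lparr>pverts = V, parcs = adj F\<rparr>"
proof -
  interpret G: pair_graph G by fact
  let ?H = "\<lparr>pverts = V, parcs = adj F\<rparr>"
  have adjD: "x \<in> V \<and> y \<in> V \<and> x \<noteq> y" if "(x, y) \<in> adj F" for x y
  proof -
    have "{x, y} \<in> F" using that by (simp add: adj_def)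
    then obtain a b where "{x, y} = {a, b}" "a \<noteq> b" "a \<in> V" "b \<in> V" using F by blast
    then show ?thesis by (auto simp: doubleton_eq_iff)
  qed
  have sym: "sym (adj F)" by (auto simp: sym_def adj_def insert_commute)
  have "adj F \<subseteq> V \<times> V" using adjD by auto
  then have finA: "finite (adj F)" using V(1) by (meson finite_SigmaI finite_subset)
  interpret H: pair_graph ?H
    using adjD finA V(1) sym by unfold_locales (auto simp: symmetric_def)
  have "subgraph (with_proj ?H) (with_proj G)"
    using sub G.wf_digraph_axioms H.wf_digraph_axioms by (auto simp: subgraph_def compatible_def)
  moreover have "Digraph_Component.connected (with_proj ?H)"
  proof -
    have reach: "(v, x) \<in> rtrancl_on V (adj F)" if "x \<in> V" for x
      using conn[OF that]
    proof (induction rule: rtrancl_induct)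
      case (step y z)
      then show ?case using adjD by (auto intro: rtrancl_on_into_rtrancl_on)
    qed (use V(2) in simp)
    have "symcl (adj F) = adj F" using sym by (auto simp: symcl_def sym_def)
    moreover have "(x, y) \<in> rtrancl_on V (adj F)" if "x \<in> V" "y \<in> V" for x y
    proof -
      have "(x, v) \<in> rtrancl_on V (adj F)"
        using rtrancl_on_sym[OF sym] reach[OF that(1)] by (auto dest: symD)
      then show ?thesis using reach[OF that(2)] by (rule rtrancl_on_trans)
    qed
    ultimately show ?thesis using V(2) by (auto simp: connected_conv)
  qed
  moreover have "excess ?H = 1"
  proof -
    have "edges ?H = F"
    proof
      show "edges ?H \<subseteq> F" by (auto simp: edges_def adj_def)
      show "F \<subseteq> edges ?H" using F by (fastforce simp: edges_def adj_def)
    qed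
    then show ?thesis using card by (simp add: excess_def)
  qed
  ultimately show ?thesis using H.pair_graph by (simp add: bicycle_def)
qed

text \<open>
  The number of arcs for which the walks outnumber \<open>x\<close>, in the form in which it enters the
  bounds of the theorem.
\<close>

lemma less_power_Suc_floor_log:
  assumes "1 < \<rho>" "1 \<le> x"
  obtains k where "x < \<rho> ^ k" "int k = \<lfloor>log \<rho> x\<rfloor> + 1"
proof -
  define k where "k = nat (\<lfloor>log \<rho> x\<rfloor> + 1)"
  have "0 \<le> log \<rho> x" using assms by simp
  then have k: "int k = \<lfloor>log \<rho> x\<rfloor> + 1" by (simp add: k_def)
  have "log \<rho> x < real_of_int (\<lfloor>log \<rho> x\<rfloor> + 1)" by linarith
  also have "\<dots> = real k" using k by (metis of_int_of_nat_eq)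
  finally have "x < \<rho> powr real k" using assms by (simp add: log_less_iff)
  then show thesis using that k assms by (simp add: powr_realpow)
qed

text \<open>
  The union of a minimal pair of walks has minimum degree at least \<open>2\<close>, so it contains a cycle,
  which cannot have more vertices than the union.
\<close>

lemma short_cycle_of_parallel_nb_walks:
  assumes G: "pair_graph G" and W: "W \<subseteq> nb_walks (parcs G) k v w" "card W = 2"
  obtains p where "graph_cycle G p" "cycle_size p \<le> 2 * k"
proof -
  interpret G: pair_graph G by fact
  have A: "sym (parcs G)" "irrefl (parcs G)"
    using G.pair_sym_arcs G.no_loops' by (auto simp: symmetric_def irrefl_def)
  obtain W' j v' w' where min: "minimal_parallel_nb_walks (parcs G) W' j v' w'"
    and W': "card W' = card W" "j \<le> k"
  proof (rule exists_minimal_parallel_nb_walks[OF A W(1)])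
    show "2 \<le> card W" using W(2) by simp
  qed
  interpret M: minimal_parallel_nb_walks "parcs G" W' j v' w' by fact
  have "sym (adj M.E)" by (auto simp: sym_def adj_def insert_commute)
  moreover have "irrefl (adj M.E)" using M.edgeD(3) unfolding irrefl_def adj_def by fast
  moreover have "adj M.E \<subseteq> M.V \<times> M.V" by (auto simp: adj_def dest: M.edgeD(1,2))
  moreover have "M.V \<noteq> {}" using M.start_in_V by auto
  ultimately obtain xs where xs: "distinct xs" "3 \<le> length xs" "set xs \<subseteq> M.V"
    "successively (\<lambda>x y. (x, y) \<in> adj M.E) xs" "(last xs, hd xs) \<in> adj M.E"
    using long_cycle_of_min_degree_two[of M.V "adj M.E"] M.finite_V M.two_neighbours
    by (auto simp: adj_def)
  have sub: "adj M.E \<subseteq> parcs G" by (auto simp: adj_def dest: M.edgeD)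
  have suc: "successively (\<lambda>x y. (x, y) \<in> parcs G) xs"
    using xs(4) sub by (auto elim!: successively_mono)
  have "length xs = card (set xs)" using xs(1) by (simp add: distinct_card)
  also have "\<dots> \<le> card M.V" using xs(3) M.finite_V by (rule card_mono[rotated])
  also have "\<dots> \<le> 2 * j" using M.card_V_le W'(1) W(2) by simp
  also have "\<dots> \<le> 2 * k" using W'(2) by simp
  finally have "length xs \<le> 2 * k" .
  then show thesis
    using that graph_cycle_of_vertex_list[OF G xs(1,2) suc] xs(5) sub by auto
qed

text \<open>
  The union of a minimal triple of walks is connected and has more edges than vertices; removing
  superfluous edges leaves a bicycle on the same vertices.
\<close>

lemma small_bicycle_of_parallel_nb_walks:
  assumes G: "pair_graph G" and W: "W \<subseteq> nb_walks (parcs G) k v w" "card W = 3"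
  obtains H where "bicycle G H" "card (pverts H) \<le> 3 * k"
proof -
  interpret G: pair_graph G by fact
  have A: "sym (parcs G)" "irrefl (parcs G)"
    using G.pair_sym_arcs G.no_loops' by (auto simp: symmetric_def irrefl_def)
  obtain W' j v' w' where min: "minimal_parallel_nb_walks (parcs G) W' j v' w'"
    and W': "card W' = card W" "j \<le> k"
  proof (rule exists_minimal_parallel_nb_walks[OF A W(1)])
    show "2 \<le> card W" using W(2) by simp
  qed
  interpret M: minimal_parallel_nb_walks "parcs G" W' j v' w' by fact
  have "Suc (card M.V) \<le> card M.E" using M.card_V_less_card_E W'(1) W(2) by simp
  then obtain F where F: "F \<subseteq> M.E" "card F = Suc (card M.V)"
    and conn: "\<And>x. x \<in> M.V \<Longrightarrow> (v', x) \<in> (adj F)\<^sup>*"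
    using trim_connected_edge_set[of M.V v' M.E "Suc (card M.V)"]
      M.finite_V M.start_in_V M.edgeD M.finite_E M.reachable_from_start by auto
  have "M.V \<subseteq> pverts G"
  proof
    fix x assume "x \<in> M.V"
    then obtain a where "{x, a} \<in> M.E" using M.two_neighbours by blast
    then show "x \<in> pverts G" using M.edgeD(4) G.in_arcsD1 by blast
  qed
  moreover have "adj F \<subseteq> parcs G" using F(1) by (auto simp: adj_def dest: M.edgeD(4))
  ultimately have "bicycle G \<lparr>pverts = M.V, parcs = adj F\<rparr>"
    using F(1) M.edge_doubleton
    by (intro bicycle_of_edge_set[OF G M.finite_V M.start_in_V _ _ _ F(2) conn]) blast+
  moreover have "card M.V \<le> 3 * k"
    using M.card_V_le W' W(2) by (metis le_trans mult_le_mono2)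
  ultimately show thesis using that by simp
qed

theorem theorem1p12:
  fixes G :: "'a pair_pre_digraph" and ds :: "('a \<times> 'a) list" and n :: nat and \<rho> :: real
  assumes "pair_graph G"
    and "card (pverts G) = n"
    and "distinct ds" and "set ds = parcs G"
    and "\<rho> = nb_spectral_radius ds"
    and "\<rho> > 1"
  shows "(\<exists>p. graph_cycle G p \<and>
            int (cycle_size p) \<le> 2 * (\<lfloor>log \<rho> (real n)\<rfloor> + 1)) \<and>
         (\<exists>H. bicycle G H \<and>
            int (card (pverts H)) \<le> 3 * (\<lfloor>log \<rho> (2 * real n)\<rfloor> + 1))"
proof -
  interpret pair_graph G by fact
  have ds: "ds \<noteq> []" using assms(5,6) by (auto simp: nb_spectral_radius_def)
  have arcs: "parcs G \<subseteq> pverts G \<times> pverts G" using in_arcsD1 in_arcsD2 by auto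
  have "parcs G \<noteq> {}" using ds assms(4) by auto
  then have "pverts G \<noteq> {}" using arcs by auto
  then have n: "1 \<le> n" using assms(2) pair_finite_verts card_gt_0_iff[of "pverts G"] by auto
  have walks: "\<exists>W v w. W \<subseteq> nb_walks (parcs G) k v w \<and> card W = Suc m"
    if "real (m * n) < \<rho> ^ k" for m k
    using exists_parallel_nb_walks[OF assms(3,4) ds arcs pair_finite_verts, of m k]
      that assms(2,5) by metis
  show ?thesis
  proof
    obtain k where k: "real n < \<rho> ^ k" "int k = \<lfloor>log \<rho> (real n)\<rfloor> + 1"
      by (rule less_power_Suc_floor_log[of \<rho> "real n"]) (use assms(6) n in auto)
    obtain W v w where "W \<subseteq> nb_walks (parcs G) k v w" "card W = 2"
      using walks[of 1 k] k(1) by (auto simp: numeral_2_eq_2)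
    then obtain p where p: "graph_cycle G p" "cycle_size p \<le> 2 * k"
      using short_cycle_of_parallel_nb_walks[OF assms(1)] by blast
    have "int (cycle_size p) \<le> 2 * int k" using p(2) by linarith
    then show "\<exists>p. graph_cycle G p \<and> int (cycle_size p) \<le> 2 * (\<lfloor>log \<rho> (real n)\<rfloor> + 1)"
      using p(1) unfolding k(2) by blast
  next
    obtain k where k: "2 * real n < \<rho> ^ k" "int k = \<lfloor>log \<rho> (2 * real n)\<rfloor> + 1"
      by (rule less_power_Suc_floor_log[of \<rho> "2 * real n"]) (use assms(6) n in auto)
    obtain W v w where "W \<subseteq> nb_walks (parcs G) k v w" "card W = 3"
      using walks[of 2 k] k(1) by (auto simp: numeral_3_eq_3)
    then obtain H where H: "bicycle G H" "card (pverts H) \<le> 3 * k"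
      using small_bicycle_of_parallel_nb_walks[OF assms(1)] by blast
    have "int (card (pverts H)) \<le> 3 * int k" using H(2) by linarith
    then show "\<exists>H. bicycle G H \<and> int (card (pverts H)) \<le> 3 * (\<lfloor>log \<rho> (2 * real n)\<rfloor> + 1)"
      using H(1) unfolding k(2) by blast
  qed
qed

end
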